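(* Let $d\geqslant 1$ and let $A \subset \mathbb{Z}^d$ be a finite set such that $H(A)$ is a $d$-simplex. Then $|NA| = P_A(N)$ for all integers $N \geqslant 1$ for which $$N \geqslant (d+1)!\operatorname{vol}(H(A)) - (d+1)(|A| - d) - d + 1.$$
   Context: For a positive integer $N$, $NA := \{a_1 + \cdots + a_N : a_i \in A\}$. By Khovanskii's theorem there is a (necessarily unique) polynomial $P_A(X) \in \mathbb{Q}[X]$ such that $|NA| = P_A(N)$ for all sufficiently large integers $N$; $P_A$ denotes this polynomial. $H(A)$ is the convex hull of $A$ in $\mathbb{R}^d$, and $\operatorname{vol}$ is $d$-dimensional Lebesgue measure. $H(A)$ is called a $d$-simplex if there exists $B \subset A$ with $|B| = d+1$ such that $B - B$ spans $\mathbb{R}^d$ and $H(A) = H(B)$. *)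

theory Defs
  imports "HOL-Analysis.Analysis" "HOL-Computational_Algebra.Polynomial"
begin

text \<open>The lattice of integer points, as a subset of Euclidean space of dimension \<open>CARD('d)\<close>.\<close>

definition int_lattice :: "(real ^ 'd::finite) set" where
  "int_lattice = {x. \<forall>i. x $ i \<in> \<int>}"

definition nfold_sumset :: "nat \<Rightarrow> 'a::comm_monoid_add set \<Rightarrow> 'a set" where
  "nfold_sumset N A = {(\<Sum>i<N. a i) | a. \<forall>i<N. a i \<in> A}"

definition eventually_counts :: "'a::comm_monoid_add set \<Rightarrow> rat poly \<Rightarrow> bool" where
  "eventually_counts A p \<longleftrightarrow>
     (\<forall>\<^sub>F N in sequentially. of_nat (card (nfold_sumset N A)) = poly p (of_nat N))"

lemma eventually_counts_unique:
  assumes "eventually_counts A p" "eventually_counts A q"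
  shows "p = q"
proof (rule ccontr)
  assume "p \<noteq> q"
  have "\<forall>\<^sub>F N in sequentially. poly (p - q) (of_nat N) = 0"
    using assms unfolding eventually_counts_def by eventually_elim simp
  then obtain M where M: "\<And>N. N \<ge> M \<Longrightarrow> poly (p - q) (of_nat N) = 0"
    by (auto simp: eventually_sequentially)
  have "of_nat ` {M..} \<subseteq> {x. poly (p - q) x = 0}"
    using M by auto
  moreover have "finite {x. poly (p - q) x = 0}"
    using \<open>p \<noteq> q\<close> by (intro poly_roots_finite) simp
  ultimately have "finite ((of_nat :: nat \<Rightarrow> rat) ` {M..})"
    by (rule finite_subset)
  then have "finite {M..}"
    by (rule finite_imageD) (simp add: inj_on_def)
  then show False
    by (simp add: infinite_Ici)
qed

text \<open>
  For finite \<open>A\<close> in the lattice, existence is Khovanskii's theorem; uniqueness is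
  the preceding lemma.
\<close>

definition khovanskii_poly :: "'a::comm_monoid_add set \<Rightarrow> rat poly" where
  "khovanskii_poly A = (THE p. eventually_counts A p)"

text \<open>
  The \<open>d\<close>-simplex condition on the convex hull of \<open>A\<close>, with \<open>d = CARD('d)\<close>. It is a
  condition on \<open>A\<close>: the vertices are required to lie in \<open>A\<close>.
\<close>

definition hull_is_simplex :: "(real ^ 'd::finite) set \<Rightarrow> bool" where
  "hull_is_simplex A \<longleftrightarrow>
     (\<exists>B\<subseteq>A. card B = CARD('d) + 1
        \<and> span {x - y | x y. x \<in> B \<and> y \<in> B} = UNIV
        \<and> convex hull A = convex hull B)"

end

theory Submission
  imports Defs
begin

text \<open>
  Write \<open>d = CARD('d)\<close> and let \<open>b\<close> enumerate the \<open>d + 1\<close> vertices of the simplex. A sum of \<open>k\<close>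
  elements of \<open>A\<close> is recorded by its barycentric coordinates, a vector in \<open>\<real>\<^bsup>d+1\<^esup>\<close> with nonnegative
  entries and total \<open>k\<close> (its height). If \<open>U\<close> is the set of coordinate vectors of the elements of
  \<open>A\<close>, then the additive monoid generated by \<open>U\<close> contains exactly \<open>card (nfold_sumset N A)\<close>
  elements of height \<open>N\<close>, because the coordinates determine the point and vice versa.

  Taking fractional parts of the coordinates splits this monoid into finitely many classes. The
  elements of the class \<open>f\<close> are the vectors \<open>f + n\<close> with \<open>n\<close> in a set \<open>W\<close> of vectors of natural
  numbers, and \<open>W\<close> is upward closed, since the unit vectors (the vertices) belong to \<open>U\<close>. If all
  minimal elements of \<open>W\<close> lie below \<open>m\<close>, then membership in \<open>W\<close> depends only on the truncation
  \<open>min n m\<close>, and summing over the finitely many truncations gives a polynomial count of the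
  elements of each height from an explicit point on
  (\<open>polynomial_from_card_truncation_closed\<close>).

  So minimal elements have to be bounded. Suppose that \<open>s = a\<^sub>1 + \<dots> + a\<^sub>k\<close> and that no vertex can be
  subtracted from \<open>s\<close> within the monoid. The partial sums of \<open>s\<close> lie in distinct classes:
  if two of them agreed modulo integers, their difference would be a nonzero sum of vertices and a
  vertex could be split off. For the same reason no partial sum of two or more terms
  lies in the class of a single element of \<open>U\<close>. Hence the partial sums other than \<open>a\<^sub>1\<close>, together
  with the non-vertices of \<open>U\<close>, occupy distinct classes, which bounds \<open>k\<close> by the number of classes
  minus \<open>card A\<close> plus \<open>d + 1\<close> (\<open>vertex_minimal_length\<close>).

  Finally the number of classes is at most \<open>d!\<close> times the volume of the simplex
  (\<open>card_classes_le_volume\<close>): each class puts about \<open>S\<^sup>d / d!\<close> lattice points into the simplex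
  dilated by \<open>S\<close>, and the unit cubes attached to these points are disjoint and fit into a
  slightly larger dilate.
\<close>

section \<open>Counting functions that are eventually polynomial\<close>

text \<open>
  The threshold is an integer rather than a natural number because it is lowered by the dimension
  in several places below and may become negative.
\<close>

definition polynomial_from :: "int \<Rightarrow> (nat \<Rightarrow> nat) \<Rightarrow> bool" where
  "polynomial_from c f \<longleftrightarrow> (\<exists>p::rat poly. \<forall>N. c \<le> int N \<longrightarrow> of_nat (f N) = poly p (of_nat N))"

lemma polynomial_from_mono:
  assumes "polynomial_from c f" and "c \<le> c'"
  shows "polynomial_from c' f"
proof -
  from assms(1) obtain p :: "rat poly"
    where "\<forall>N. c \<le> int N \<longrightarrow> of_nat (f N) = poly p (of_nat N)"
    by (auto simp: polynomial_from_def)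
  then show ?thesis
    unfolding polynomial_from_def using assms(2) by (intro exI[of _ p]) auto
qed

lemma polynomial_from_sum:
  assumes "\<And>x. x \<in> X \<Longrightarrow> polynomial_from c (f x)"
  shows "polynomial_from c (\<lambda>N. \<Sum>x\<in>X. f x N)"
proof -
  have "\<forall>x\<in>X. \<exists>p::rat poly. \<forall>N. c \<le> int N \<longrightarrow> of_nat (f x N) = poly p (of_nat N)"
    using assms by (auto simp: polynomial_from_def)
  then obtain p :: "'a \<Rightarrow> rat poly"
    where p: "\<And>x N. x \<in> X \<Longrightarrow> c \<le> int N \<Longrightarrow> of_nat (f x N) = poly (p x) (of_nat N)"
    by metis
  then show ?thesis
    unfolding polynomial_from_def
    by (intro exI[of _ "\<Sum>x\<in>X. p x"]) (auto simp: poly_sum intro!: sum.cong)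
qed

text \<open>
  Uniqueness of the eventual polynomial turns any polynomial that is correct from some point on
  into the Khovanskii polynomial.
\<close>

lemma khovanskii_poly_eq:
  assumes "polynomial_from c (\<lambda>N. card (nfold_sumset N A))" and "c \<le> int N"
  shows "of_nat (card (nfold_sumset N A)) = poly (khovanskii_poly A) (of_nat N)"
proof -
  from assms(1) obtain p :: "rat poly"
    where p: "\<And>N. c \<le> int N \<Longrightarrow> of_nat (card (nfold_sumset N A)) = poly p (of_nat N)"
    by (auto simp: polynomial_from_def)
  have "eventually_counts A p"
    unfolding eventually_counts_def eventually_sequentially
    by (intro exI[of _ "nat c"]) (auto intro!: p)
  then have "khovanskii_poly A = p"
    unfolding khovanskii_poly_def by (blast intro: eventually_counts_unique)
  with p assms(2) show ?thesis by simp
qed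

text \<open>
  The polynomial is \<open>(N - c + 1) \<cdots> (N - c + r) / r!\<close>. It vanishes at the \<open>r\<close> integers just below
  \<open>c\<close>, where the counting function is zero as well; this lowers the threshold by \<open>r\<close>.
\<close>

lemma polynomial_from_choose:
  "polynomial_from (int c - int r) (\<lambda>N. if c \<le> N then (N - c + r) choose r else 0)"
proof -
  define q :: "rat poly" where "q = (\<Prod>i\<in>{1..r}. [:of_nat i - of_nat c, 1:])"
  have q: "poly q (of_nat N) = (\<Prod>i\<in>{1..r}. of_nat i - of_nat c + of_nat N)" for N
    unfolding q_def poly_prod by simp
  have "of_nat (if c \<le> N then (N - c + r) choose r else 0) = poly (smult (1 / fact r) q) (of_nat N)"
    if N: "int c - int r \<le> int N" for N
  proof (cases "c \<le> N")
    case True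
    define M where "M = N - c"
    have "poly q (of_nat N) = (\<Prod>i\<in>{1..r}. of_nat i + of_nat M)"
      unfolding q by (rule prod.cong) (use True in \<open>auto simp: M_def of_nat_diff\<close>)
    also have "\<dots> = pochhammer (of_nat M + 1) r"
      unfolding pochhammer_prod
      by (rule prod.reindex_bij_witness[of _ "\<lambda>i. i + 1" "\<lambda>i. i - 1"]) auto
    finally have "poly q (of_nat N) = pochhammer (of_nat M + 1) r" .
    moreover have "of_nat ((M + r) choose r) = (pochhammer (of_nat M + 1) r :: rat) / fact r"
      by (simp add: binomial_gbinomial gbinomial_pochhammer')
    ultimately show ?thesis using True by (simp add: M_def)
  next
    case False
    have "of_nat (c - N) - of_nat c + of_nat N = (0 :: rat)"
      using False by (simp add: of_nat_diff)
    moreover have "c - N \<in> {1..r}" using False N by auto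
    ultimately have "poly q (of_nat N) = 0"
      unfolding q by (intro prod_zero bexI[of _ "c - N"]) auto
    with False show ?thesis by simp
  qed
  then show ?thesis unfolding polynomial_from_def by blast
qed

text \<open>
  Stars and bars: such functions are the multisets of size \<open>M\<close> over \<open>J\<close>.
\<close>

lemma card_compositions:
  fixes J :: "'v::finite set"
  assumes "J \<noteq> {}"
  shows "card {e :: 'v \<Rightarrow> nat. (\<forall>i. i \<notin> J \<longrightarrow> e i = 0) \<and> sum e UNIV = M}
           = (M + (card J - 1)) choose (card J - 1)"
    (is "card ?E = _")
proof -
  have size: "sum (count X) UNIV = size X" for X :: "'v multiset"
    unfolding size_multiset_overloaded_eq
    by (rule sum.mono_neutral_right) (auto simp: not_in_iff)
  have "bij_betw count (multisets_of_size J M) ?E"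
  proof (rule bij_betw_byWitness[where f' = Abs_multiset])
    have c: "count (Abs_multiset e) = e" for e :: "'v \<Rightarrow> nat"
      by (rule Abs_multiset_inverse) simp
    show "\<forall>X\<in>multisets_of_size J M. Abs_multiset (count X) = X"
      by (simp add: count_inverse)
    show "\<forall>e\<in>?E. count (Abs_multiset e) = e"
      by (simp add: c)
    show "count ` multisets_of_size J M \<subseteq> ?E"
    proof (intro image_subsetI CollectI conjI allI impI)
      fix X i assume X: "X \<in> multisets_of_size J M"
      then show "sum (count X) UNIV = M" by (simp add: multisets_of_size_def size)
      show "count X i = 0" if "i \<notin> J"
        using X that by (auto simp: multisets_of_size_def count_eq_zero_iff)
    qed
    show "Abs_multiset ` ?E \<subseteq> multisets_of_size J M"
    proof (intro image_subsetI)
      fix e assume e: "e \<in> ?E"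
      have "set_mset (Abs_multiset e) \<subseteq> J"
        using e by (auto simp: set_mset_def c)
      moreover have "size (Abs_multiset e) = M"
        using e size[of "Abs_multiset e"] by (simp add: c)
      ultimately show "Abs_multiset e \<in> multisets_of_size J M"
        by (simp add: multisets_of_size_def)
    qed
  qed
  from bij_betw_same_card[OF this] have "card ?E = (card J + M - 1) choose M"
    by (simp only: card_multisets_of_size[OF finite])
  also have "\<dots> = (M + (card J - 1)) choose (card J - 1)"
  proof -
    have "card J \<ge> 1" using assms by (simp add: Suc_le_eq card_gt_0_iff)
    then show ?thesis
      using binomial_symmetric[of M "card J + M - 1"] by (simp add: add.commute)
  qed
  finally show ?thesis .
qed

text \<open>
  Subtracting \<open>t\<close> leaves the compositions of \<open>N - h - sum t UNIV\<close> into parts indexed by the free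
  coordinates \<open>J\<close>. If \<open>J\<close> is empty, the set contains only \<open>t\<close>, which is counted at the single value
  \<open>N = h + sum t UNIV\<close>; beyond it the zero polynomial is correct, in accordance with the general
  threshold.
\<close>

lemma polynomial_from_card_cylinder:
  fixes J :: "'v::finite set" and t :: "'v \<Rightarrow> nat"
  shows "polynomial_from (int h + int (sum t UNIV) - int (card J) + 1)
           (\<lambda>N. card {n. (\<forall>i. i \<notin> J \<longrightarrow> n i = t i) \<and> (\<forall>i\<in>J. t i \<le> n i) \<and> sum n UNIV + h = N})"
    (is "polynomial_from ?c (\<lambda>N. card (?C N))")
proof (cases "J = {}")
  case True
  have empty: "?C N = {}" if "?c \<le> int N" for N
  proof -
    have "n = t" if "\<forall>i. n i = t i" for n using that by auto
    with True that show ?thesis by auto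
  qed
  then have "of_nat (card (?C N)) = poly (0::rat poly) (of_nat N)" if "?c \<le> int N" for N
    by (simp only: empty[OF that] card.empty of_nat_0 poly_0)
  then show ?thesis
    unfolding polynomial_from_def by blast
next
  case False
  define c where "c = h + sum t UNIV"
  have eq: "card (?C N) = (if c \<le> N then (N - c + (card J - 1)) choose (card J - 1) else 0)" for N
  proof (cases "c \<le> N")
    case True
    have "bij_betw (\<lambda>e i. e i + t i)
        {e. (\<forall>i. i \<notin> J \<longrightarrow> e i = 0) \<and> sum e UNIV = N - c} (?C N)"
    proof (rule bij_betw_byWitness[where f' = "\<lambda>n i. n i - t i"])
      show "(\<lambda>e i. e i + t i) ` {e. (\<forall>i. i \<notin> J \<longrightarrow> e i = 0) \<and> sum e UNIV = N - c} \<subseteq> ?C N"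
      proof (intro image_subsetI CollectI)
        fix e :: "'v \<Rightarrow> nat"
        assume "e \<in> {e. (\<forall>i. i \<notin> J \<longrightarrow> e i = 0) \<and> sum e UNIV = N - c}"
        then have e: "\<forall>i. i \<notin> J \<longrightarrow> e i = 0" "sum e UNIV = N - c" by blast+
        have "(\<Sum>i\<in>UNIV. e i + t i) + h = N"
          using True e(2) unfolding c_def sum.distrib by linarith
        with e(1) show "(\<forall>i. i \<notin> J \<longrightarrow> e i + t i = t i) \<and> (\<forall>i\<in>J. t i \<le> e i + t i)
            \<and> (\<Sum>i\<in>UNIV. e i + t i) + h = N" by simp
      qed
      show "(\<lambda>n i. n i - t i) ` ?C N \<subseteq> {e. (\<forall>i. i \<notin> J \<longrightarrow> e i = 0) \<and> sum e UNIV = N - c}"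
      proof clarsimp
        fix n assume n: "\<forall>i. i \<notin> J \<longrightarrow> n i = t i" "\<forall>i\<in>J. t i \<le> n i"
        then have "t i \<le> n i" for i by (cases "i \<in> J") auto
        then have "(\<Sum>i\<in>UNIV. n i - t i) = sum n UNIV - sum t UNIV"
          by (intro sum_subtractf_nat) auto
        then show "(\<Sum>i\<in>UNIV. n i - t i) = sum n UNIV + h - c" by (simp add: c_def)
      qed
      show "\<forall>n\<in>?C N. (\<lambda>i. n i - t i + t i) = n"
      proof (intro ballI ext)
        fix n i assume "n \<in> ?C N"
        then show "n i - t i + t i = n i" by (cases "i \<in> J") auto
      qed
      show "\<forall>e\<in>{e. (\<forall>i. i \<notin> J \<longrightarrow> e i = 0) \<and> sum e UNIV = N - c}. (\<lambda>i. e i + t i - t i) = e"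
        by (intro ballI ext) (rule diff_add_inverse2)
    qed
    from bij_betw_same_card[OF this] card_compositions[OF False, of "N - c"] True show ?thesis
      by (simp only: if_True)
  next
    case c: False
    have empty: "?C N = {}"
    proof (rule ccontr)
      assume "?C N \<noteq> {}"
      then obtain n where n: "\<forall>i. i \<notin> J \<longrightarrow> n i = t i" "\<forall>i\<in>J. t i \<le> n i" "sum n UNIV + h = N"
        by blast
      have "t i \<le> n i" for i using n by (cases "i \<in> J") auto
      then have "sum t UNIV \<le> sum n UNIV" by (simp add: sum_mono)
      with n(3) c show False by (simp add: c_def)
    qed
    show ?thesis by (simp only: empty c card.empty if_False)
  qed
  have c: "int c - int (card J - 1) = ?c"
  proof -
    have "card J \<ge> 1" using False by (simp add: Suc_le_eq card_gt_0_iff)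
    then show ?thesis by (simp add: c_def)
  qed
  have "(\<lambda>N. card (?C N)) = (\<lambda>N. if c \<le> N then (N - c + (card J - 1)) choose (card J - 1) else 0)"
    by (rule ext) (rule eq)
  from arg_cong[OF this, of "polynomial_from ?c"] polynomial_from_choose[of c "card J - 1", unfolded c]
  show ?thesis by (rule iffD2)
qed

lemma finite_bounded_functions:
  fixes m :: "'v::finite \<Rightarrow> nat"
  shows "finite {t. \<forall>i. t i \<le> m i}"
proof -
  have "{t. \<forall>i. t i \<le> m i} = PiE UNIV (\<lambda>i. {..m i})" by auto
  then show ?thesis by (simp add: finite_PiE)
qed

lemma finite_bounded_sum:
  "finite {n :: 'v::finite \<Rightarrow> nat. sum n UNIV + h = N}"
proof (rule finite_subset[OF _ finite_bounded_functions])
  show "{n :: 'v \<Rightarrow> nat. sum n UNIV + h = N} \<subseteq> {t. \<forall>i. t i \<le> N}"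
  proof clarify
    fix n :: "'v \<Rightarrow> nat" and i
    have "n i \<le> sum n UNIV" by (rule member_le_sum) auto
    then show "n i \<le> sum n UNIV + h" by simp
  qed
qed

text \<open>
  The functions with a given truncation \<open>t\<close> form a cylinder whose free coordinates are those with
  \<open>t i = m i\<close>. On the other coordinates \<open>t i + 1 \<le> m i\<close>, so passing from \<open>t\<close> to \<open>m\<close> raises the
  sum by at least the number of coordinates that are not free, and the threshold of every cylinder
  is at most the one for \<open>t = m\<close>. The offset \<open>h\<close> is the height at which a class starts.
\<close>

lemma polynomial_from_card_truncation_closed:
  fixes W :: "('v::finite \<Rightarrow> nat) set" and m :: "'v \<Rightarrow> nat"
  assumes W: "\<And>n. n \<in> W \<longleftrightarrow> (\<lambda>i. min (n i) (m i)) \<in> W"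
  shows "polynomial_from (int h + int (sum m UNIV) - int CARD('v) + 1)
           (\<lambda>N. card {n\<in>W. sum n UNIV + h = N})"
proof -
  define T where "T = {t\<in>W. \<forall>i. t i \<le> m i}"
  define J where "J t = {i. t i = m i}" for t :: "'v \<Rightarrow> nat"
  define C where "C t N = {n. (\<forall>i. i \<notin> J t \<longrightarrow> n i = t i) \<and> (\<forall>i\<in>J t. t i \<le> n i) \<and> sum n UNIV + h = N}"
    for t N
  have "finite T"
    unfolding T_def by (rule finite_subset[OF _ finite_bounded_functions[of m]]) auto
  have C: "n \<in> C t N \<longleftrightarrow> (\<lambda>i. min (n i) (m i)) = t \<and> sum n UNIV + h = N" if "t \<in> T" for n t N
  proof -
    have "(i \<notin> J t \<longrightarrow> n i = t i) \<and> (i \<in> J t \<longrightarrow> t i \<le> n i) \<longleftrightarrow> min (n i) (m i) = t i" for i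
    proof -
      have "t i \<le> m i" using that by (auto simp: T_def)
      then show ?thesis by (auto simp: J_def min_def)
    qed
    then show ?thesis unfolding C_def fun_eq_iff by blast
  qed
  have "card {n\<in>W. sum n UNIV + h = N} = (\<Sum>t\<in>T. card (C t N))" for N
  proof -
    have "{n\<in>W. sum n UNIV + h = N} = (\<Union>t\<in>T. C t N)"
    proof (intro set_eqI)
      fix n
      have "n \<in> W \<longleftrightarrow> (\<lambda>i. min (n i) (m i)) \<in> T"
        using W[of n] by (simp add: T_def)
      then show "n \<in> {n\<in>W. sum n UNIV + h = N} \<longleftrightarrow> n \<in> (\<Union>t\<in>T. C t N)"
        by (auto simp: C)
    qed
    moreover have "card (\<Union>t\<in>T. C t N) = (\<Sum>t\<in>T. card (C t N))"
    proof (rule card_UN_disjoint)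
      show "\<forall>t\<in>T. finite (C t N)"
        unfolding C_def by (auto intro: finite_subset[OF _ finite_bounded_sum[of h N]])
      show "\<forall>t\<in>T. \<forall>u\<in>T. t \<noteq> u \<longrightarrow> C t N \<inter> C u N = {}"
        by (auto simp: C)
    qed fact
    ultimately show ?thesis by (simp only:)
  qed
  moreover have "polynomial_from (int h + int (sum m UNIV) - int CARD('v) + 1) (\<lambda>N. card (C t N))"
    if "t \<in> T" for t
  proof (rule polynomial_from_mono)
    show "polynomial_from (int h + int (sum t UNIV) - int (card (J t)) + 1) (\<lambda>N. card (C t N))"
      unfolding C_def by (rule polynomial_from_card_cylinder)
    have "t i + (if i \<in> J t then 0 else 1) \<le> m i" for i
    proof -
      have "t i \<le> m i" using that by (auto simp: T_def)
      then show ?thesis by (auto simp: J_def)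
    qed
    then have "(\<Sum>i\<in>UNIV. t i + (if i \<in> J t then 0 else 1)) \<le> sum m UNIV"
      by (simp add: sum_mono)
    moreover have "(\<Sum>i\<in>UNIV. if i \<in> J t then 0 else 1) = card (- J t)"
      by (subst sum.If_cases) (auto)
    ultimately have "sum t UNIV + card (- J t) \<le> sum m UNIV"
      by (simp add: sum.distrib)
    moreover have "card (- J t) + card (J t) = CARD('v)"
      by (metis add.commute card_Un_disjoint Compl_disjoint Compl_partition finite)
    ultimately show "int h + int (sum t UNIV) - int (card (J t)) + 1
        \<le> int h + int (sum m UNIV) - int CARD('v) + 1" by linarith
  qed
  ultimately show ?thesis by (simp only: polynomial_from_sum)
qed

section \<open>Sumsets\<close>

lemma nfold_sumset_0: "nfold_sumset 0 A = {0}"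
  by (auto simp: nfold_sumset_def)

lemma nfold_sumset_add:
  assumes "x \<in> nfold_sumset j A" and "y \<in> nfold_sumset k A"
  shows "x + y \<in> nfold_sumset (j + k) A"
proof -
  from assms obtain a b where a: "x = (\<Sum>i<j. a i)" "\<forall>i<j. a i \<in> A"
    and b: "y = (\<Sum>i<k. b i)" "\<forall>i<k. b i \<in> A"
    by (auto simp: nfold_sumset_def)
  define c where "c i = (if i < j then a i else b (i - j))" for i
  have "(\<Sum>i<j + k. c i) = (\<Sum>i<j. c i) + (\<Sum>i\<in>{j..<j + k}. c i)"
    by (metis ivl_disj_un_one(2) sum.union_disjoint finite_lessThan finite_atLeastLessThan
        ivl_disj_int_one(2) le_add1)
  also have "(\<Sum>i<j. c i) = x" by (simp add: c_def a)
  also have "(\<Sum>i\<in>{j..<j + k}. c i) = y"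
    unfolding b
    by (rule sum.reindex_bij_witness[of _ "\<lambda>i. i + j" "\<lambda>i. i - j"]) (auto simp: c_def)
  finally have "x + y = (\<Sum>i<j + k. c i)" ..
  moreover have "\<forall>i<j + k. c i \<in> A"
    using a(2) b(2) by (auto simp: c_def)
  ultimately show ?thesis by (auto simp: nfold_sumset_def)
qed

lemma mem_nfold_sumset_1: "a \<in> A \<Longrightarrow> a \<in> nfold_sumset 1 A"
  by (auto simp: nfold_sumset_def intro!: exI[of _ "\<lambda>_. a"])

lemma nfold_sumset_image:
  assumes "f 0 = 0" and "\<And>x y. f (x + y) = f x + f y"
  shows "nfold_sumset N (f ` A) = f ` nfold_sumset N A"
proof (intro set_eqI iffI)
  have f: "f (\<Sum>i<N. a i) = (\<Sum>i<N. f (a i))" for a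
    by (induction N) (simp_all add: assms)
  fix y
  {
    assume "y \<in> nfold_sumset N (f ` A)"
    then obtain b where b: "y = (\<Sum>i<N. b i)" "\<forall>i<N. b i \<in> f ` A"
      by (auto simp: nfold_sumset_def)
    then have "\<forall>i. \<exists>a. i < N \<longrightarrow> a \<in> A \<and> b i = f a" by blast
    from choice[OF this] obtain a where a: "\<forall>i<N. a i \<in> A \<and> b i = f (a i)" by blast
    with b(1) have "y = f (\<Sum>i<N. a i)" by (simp add: f)
    moreover from a have "\<forall>i<N. a i \<in> A" by blast
    ultimately show "y \<in> f ` nfold_sumset N A" by (auto simp: nfold_sumset_def)
  next
    assume "y \<in> f ` nfold_sumset N A"
    then obtain a where "y = (\<Sum>i<N. f (a i))" "\<forall>i<N. a i \<in> A"
      by (auto simp: nfold_sumset_def f)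
    then show "y \<in> nfold_sumset N (f ` A)"
      unfolding nfold_sumset_def by (intro CollectI exI[of _ "\<lambda>i. f (a i)"]) auto
  }
qed

definition sum_monoid :: "'a::comm_monoid_add set \<Rightarrow> 'a set" where
  "sum_monoid A = (\<Union>k. nfold_sumset k A)"

lemma sum_monoid_add: "x \<in> sum_monoid A \<Longrightarrow> y \<in> sum_monoid A \<Longrightarrow> x + y \<in> sum_monoid A"
  unfolding sum_monoid_def using nfold_sumset_add by blast

lemma sum_monoid_base: "a \<in> A \<Longrightarrow> a \<in> sum_monoid A"
  unfolding sum_monoid_def using mem_nfold_sumset_1 by blast

lemma sum_monoid_0: "0 \<in> sum_monoid A"
  unfolding sum_monoid_def using nfold_sumset_0 by blast

lemma sum_in_sum_monoid:
  "(\<And>x. x \<in> X \<Longrightarrow> f x \<in> sum_monoid A) \<Longrightarrow> sum f X \<in> sum_monoid A"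
  by (induction X rule: infinite_finite_induct) (auto intro: sum_monoid_add sum_monoid_0)

section \<open>Barycentric coordinates\<close>

definition height :: "real ^ 'v::finite \<Rightarrow> real" where
  "height x = (\<Sum>i\<in>UNIV. x $ i)"

definition frac_vec :: "real ^ 'v::finite \<Rightarrow> real ^ 'v" where
  "frac_vec x = (\<chi> i. frac (x $ i))"

definition nat_vec :: "('v::finite \<Rightarrow> nat) \<Rightarrow> real ^ 'v" where
  "nat_vec n = (\<chi> i. real (n i))"

lemma nat_vec_nth [simp]: "nat_vec n $ i = real (n i)"
  by (simp add: nat_vec_def)

lemma height_add: "height (x + y) = height x + height y"
  by (simp add: height_def sum.distrib)

lemma height_nat_vec: "height (nat_vec n) = real (sum n UNIV)"
  by (simp add: height_def)

lemma frac_vec_nth [simp]: "frac_vec x $ i = frac (x $ i)"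
  by (simp add: frac_vec_def)

lemma frac_vec_add_nat_vec: "frac_vec (x + nat_vec n) = frac_vec x"
  by (simp add: vec_eq_iff frac_def)

lemma frac_vec_idem: "frac_vec (frac_vec x) = frac_vec x"
  by (simp add: vec_eq_iff)

lemma diff_eq_nat_vec:
  assumes "frac_vec x = frac_vec y" and "\<And>i. x $ i \<le> y $ i"
  obtains n where "y = x + nat_vec n"
proof
  show "y = x + nat_vec (\<lambda>i. nat (\<lfloor>y $ i\<rfloor> - \<lfloor>x $ i\<rfloor>))"
  proof (subst vec_eq_iff, intro allI)
    fix i
    have "frac (x $ i) = frac (y $ i)"
      using assms(1) by (metis frac_vec_nth)
    moreover have "\<lfloor>x $ i\<rfloor> \<le> \<lfloor>y $ i\<rfloor>" using assms(2) by (rule floor_mono)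
    ultimately show "y $ i = (x + nat_vec (\<lambda>i. nat (\<lfloor>y $ i\<rfloor> - \<lfloor>x $ i\<rfloor>))) $ i"
      by (simp add: frac_def)
  qed
qed

lemma nonneg_eq_frac_vec_add:
  assumes "\<And>i. 0 \<le> x $ i"
  obtains n where "x = frac_vec x + nat_vec n"
proof (rule diff_eq_nat_vec)
  show "frac_vec x $ i \<le> x $ i" for i
    using assms[of i] by (simp add: frac_def)
qed (use frac_vec_idem that in auto)

text \<open>
  The set \<open>U\<close> consists of barycentric coordinate vectors of points in a simplex whose vertices are
  indexed by \<open>'v\<close>; the vertices themselves, which are the unit vectors, are among them. The
  dimension of the simplex is \<open>CARD('v) - 1\<close>.
\<close>

locale simplex_coordinates =
  fixes U :: "(real ^ 'v::finite) set"
  assumes finite_U: "finite U"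
    and vertex_in: "axis i 1 \<in> U"
    and coord_nonneg: "u \<in> U \<Longrightarrow> 0 \<le> u $ i"
    and height_one: "u \<in> U \<Longrightarrow> height u = 1"
begin

text \<open>
  These are the cosets of the lattice of integer vectors that meet the monoid, each represented by
  its vector in the half-open unit cube.
\<close>

definition classes :: "(real ^ 'v) set" where
  "classes = frac_vec ` sum_monoid U"

lemma height_nfold: "x \<in> nfold_sumset k U \<Longrightarrow> height x = real k"
proof -
  assume "x \<in> nfold_sumset k U"
  then obtain a where a: "x = (\<Sum>i<k. a i)" "\<forall>i<k. a i \<in> U" by (auto simp: nfold_sumset_def)
  have "height x = (\<Sum>i<k. height (a i))"
    unfolding a height_def by (subst sum.swap) (simp add: sum_component)
  also have "\<dots> = real k" using a(2) by (simp add: height_one)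
  finally show ?thesis .
qed

lemma sum_monoid_nonneg: "x \<in> sum_monoid U \<Longrightarrow> 0 \<le> x $ i"
proof -
  assume "x \<in> sum_monoid U"
  then obtain k a where "x = (\<Sum>j<(k::nat). a j)" "\<forall>j<k. a j \<in> U"
    by (auto simp: sum_monoid_def nfold_sumset_def)
  then show ?thesis using coord_nonneg by (auto intro!: sum_nonneg)
qed

lemma nfold_iff: "x \<in> nfold_sumset N U \<longleftrightarrow> x \<in> sum_monoid U \<and> height x = real N"
  unfolding sum_monoid_def using height_nfold by fastforce

lemma nat_vec_in: "nat_vec n \<in> sum_monoid U"
proof -
  have m: "of_nat k *\<^sub>R axis i 1 \<in> sum_monoid U" for k i
    by (induction k)
      (auto simp: scaleR_add_left sum_monoid_0 intro: sum_monoid_add sum_monoid_base[OF vertex_in])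
  have "nat_vec n = (\<Sum>i\<in>UNIV. real (n i) *\<^sub>R axis i 1)"
    by (simp add: vec_eq_iff axis_def sum_component if_distrib cong: if_cong)
  then show ?thesis using m by (simp add: sum_in_sum_monoid)
qed

text \<open>
  Every element of the monoid is obtained from one of these by adding vertices, so they determine
  each class completely.
\<close>

definition vertex_minimal :: "real ^ 'v \<Rightarrow> bool" where
  "vertex_minimal s \<longleftrightarrow> s \<in> sum_monoid U \<and> (\<forall>i. s - axis i 1 \<notin> sum_monoid U)"

text \<open>
  An exchange argument: \<open>y - x\<close> is a vector of natural numbers, that is, a sum of vertices. If it is
  nonzero, one of these vertices can be removed from \<open>y + z = x + (y - x) + z\<close> without leaving the
  monoid.
\<close>

lemma vertex_minimal_summand:
  assumes "vertex_minimal (y + z)" and "x \<in> sum_monoid U" and "z \<in> sum_monoid U"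
    and "frac_vec x = frac_vec y" and "\<And>i. x $ i \<le> y $ i"
  shows "x = y"
proof -
  obtain n where n: "y = x + nat_vec n" using diff_eq_nat_vec[OF assms(4,5)] by blast
  have "n i = 0" for i
  proof (rule ccontr)
    assume "n i \<noteq> 0"
    then have "nat_vec n - axis i 1 = nat_vec (n(i := n i - 1))"
      by (auto simp: vec_eq_iff axis_def of_nat_diff)
    then have "y + z - axis i 1 = x + nat_vec (n(i := n i - 1)) + z"
      using n by (simp add: algebra_simps)
    also have "\<dots> \<in> sum_monoid U"
      using assms(2,3) by (intro sum_monoid_add nat_vec_in)
    finally show False using assms(1) by (auto simp: vertex_minimal_def)
  qed
  then show ?thesis using n by (simp add: vec_eq_iff)
qed

text \<open>
  A coordinate of size one uses up the whole height, so it occurs only at a vertex.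
\<close>

lemma coord_less_one:
  assumes "u \<in> U" and "u \<notin> range (\<lambda>i. axis i 1)"
  shows "u $ i < 1"
proof (rule ccontr)
  assume "\<not> u $ i < 1"
  moreover have h: "u $ i + (\<Sum>j\<in>UNIV - {i}. u $ j) = 1"
    using height_one[OF assms(1)] unfolding height_def by (simp add: sum.remove[of UNIV i])
  moreover have nn: "0 \<le> (\<Sum>j\<in>UNIV - {i}. u $ j)"
    by (intro sum_nonneg coord_nonneg assms(1))
  ultimately have i: "u $ i = 1" and "(\<Sum>j\<in>UNIV - {i}. u $ j) = 0" by auto
  then have "\<forall>j\<in>UNIV - {i}. u $ j = 0"
    by (subst (asm) sum_nonneg_eq_0_iff) (auto intro: coord_nonneg assms(1))
  with i have "u = axis i 1" by (auto simp: vec_eq_iff axis_def)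
  with assms(2) show False by blast
qed

text \<open>
  In particular distinct non-vertices of \<open>U\<close> lie in distinct classes.
\<close>

lemma frac_vec_nonvertex:
  assumes "u \<in> U" and "u \<notin> range (\<lambda>i. axis i 1)"
  shows "frac_vec u = u"
  using coord_less_one[OF assms] coord_nonneg[OF assms(1)] by (simp add: vec_eq_iff frac_eq)

text \<open>
  The partial sums \<open>\<sigma> j\<close> with \<open>j \<noteq> 1\<close> and the non-vertices of \<open>U\<close> all have different classes. The
  index \<open>j = 1\<close> is left out because \<open>\<sigma> 1\<close> is itself an element of \<open>U\<close>. For \<open>k = 0\<close> the empty
  partial sum still occupies one class, whence the maximum on the left-hand side.
\<close>

lemma vertex_minimal_length:
  assumes s: "vertex_minimal s" "s \<in> nfold_sumset k U" and fin: "finite classes"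
  shows "max 1 k + card U \<le> card classes + CARD('v)"
proof -
  define E where "E = range (\<lambda>i::'v. axis i (1::real))"
  obtain a where a: "s = (\<Sum>i<k. a i)" "\<forall>i<k. a i \<in> U"
    using s(2) by (auto simp: nfold_sumset_def)
  define \<sigma> where "\<sigma> j = (\<Sum>i<j. a i)" for j
  have \<sigma>_nfold: "\<sigma> j \<in> nfold_sumset j U" if "j \<le> k" for j
    using that a(2) by (auto simp: \<sigma>_def nfold_sumset_def)
  then have \<sigma>_in: "\<sigma> j \<in> sum_monoid U" if "j \<le> k" for j
    using that by (auto simp: sum_monoid_def)
  have \<sigma>_height: "height (\<sigma> j) = real j" if "j \<le> k" for j
    using \<sigma>_nfold[OF that] by (rule height_nfold)
  have no_swap: "x = \<sigma> j"
    if "j \<le> k" "x \<in> sum_monoid U" "frac_vec x = frac_vec (\<sigma> j)" "\<And>i. x $ i \<le> \<sigma> j $ i" for x j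
  proof (rule vertex_minimal_summand[where z = "\<Sum>i\<in>{j..<k}. a i"])
    have "\<sigma> j + (\<Sum>i\<in>{j..<k}. a i) = s"
      unfolding \<sigma>_def a using that(1)
      by (metis atLeast0LessThan sum.atLeastLessThan_concat zero_le)
    with s(1) show "vertex_minimal (\<sigma> j + (\<Sum>i\<in>{j..<k}. a i))" by simp
    show "(\<Sum>i\<in>{j..<k}. a i) \<in> sum_monoid U"
      using a(2) by (intro sum_in_sum_monoid sum_monoid_base) auto
  qed (use that in auto)
  \<comment> \<open>the later of two congruent partial sums could be replaced by the earlier one\<close>
  have inj: "inj_on (\<lambda>j. frac_vec (\<sigma> j)) ({..k} - {1})"
  proof (rule linorder_inj_onI)
    fix j l assume jl: "j < l" "j \<in> {..k} - {1}" "l \<in> {..k} - {1}"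
    show "frac_vec (\<sigma> j) \<noteq> frac_vec (\<sigma> l)"
    proof
      assume eq: "frac_vec (\<sigma> j) = frac_vec (\<sigma> l)"
      have "\<sigma> l = \<sigma> j + (\<Sum>i\<in>{j..<l}. a i)"
        unfolding \<sigma>_def using jl(1)
        by (metis atLeast0LessThan sum.atLeastLessThan_concat zero_le less_imp_le)
      moreover have "(\<Sum>i\<in>{j..<l}. a i) \<in> sum_monoid U"
        using a(2) jl by (intro sum_in_sum_monoid sum_monoid_base) auto
      ultimately have "\<sigma> j $ i \<le> \<sigma> l $ i" for i
        using sum_monoid_nonneg[of "\<Sum>i\<in>{j..<l}. a i" i] by (simp only: vector_add_component) simp
      moreover have "j \<le> k" "l \<le> k" using jl by auto
      ultimately have "\<sigma> j = \<sigma> l" using no_swap[OF _ \<sigma>_in eq] by blast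
      then have "height (\<sigma> j) = height (\<sigma> l)" by (rule arg_cong)
      with \<sigma>_height[OF \<open>j \<le> k\<close>] \<sigma>_height[OF \<open>l \<le> k\<close>] jl(1) show False by simp
    qed
  qed auto
  \<comment> \<open>a partial sum congruent to a single element could be replaced by that element\<close>
  have disj: "(\<lambda>j. frac_vec (\<sigma> j)) ` ({..k} - {1}) \<inter> (U - E) = {}"
  proof (rule ccontr)
    assume "\<not> ?thesis"
    then obtain j u where ju: "j \<le> k" "j \<noteq> 1" "u \<in> U" "u \<notin> E" "u = frac_vec (\<sigma> j)" by blast
    have "frac_vec u = u" using ju by (intro frac_vec_nonvertex) (auto simp: E_def)
    with ju(5) have "frac_vec u = frac_vec (\<sigma> j)" by (simp only:)
    moreover have "u $ i \<le> \<sigma> j $ i" for i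
      using sum_monoid_nonneg[OF \<sigma>_in[OF ju(1)], of i] by (simp add: ju(5) frac_def)
    ultimately have "u = \<sigma> j"
      using no_swap[OF ju(1) sum_monoid_base[OF ju(3)]] by blast
    then show False using \<sigma>_height[OF ju(1)] height_one[OF ju(3)] ju(2) by simp
  qed
  have E: "E \<subseteq> U" "card E = CARD('v)" "finite E"
    using vertex_in by (auto simp: E_def card_image inj_on_def axis_eq_axis)
  have sub: "(\<lambda>j. frac_vec (\<sigma> j)) ` ({..k} - {1}) \<union> (U - E) \<subseteq> classes"
  proof -
    have "u \<in> classes" if "u \<in> U" "u \<notin> E" for u
      using frac_vec_nonvertex[of u] sum_monoid_base[of u U] that by (force simp: classes_def E_def)
    then show ?thesis using \<sigma>_in by (auto simp: classes_def)
  qed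
  have "card ({..k} - {1}) + card (U - E)
      = card ((\<lambda>j. frac_vec (\<sigma> j)) ` ({..k} - {1}) \<union> (U - E))"
    using disj inj finite_U by (subst card_Un_disjoint) (auto simp: card_image)
  also have "\<dots> \<le> card classes" by (rule card_mono[OF fin sub])
  finally have "card ({..k} - {1}) + card (U - E) \<le> card classes" .
  moreover have "max 1 k \<le> card ({..k} - {1})"
    using diff_card_le_card_Diff[of "{1}" "{..k}"] by (cases "k = 0") auto
  moreover have "card (U - E) = card U - CARD('v)"
    using E by (simp add: card_Diff_subset)
  moreover have "CARD('v) \<le> card U" using E card_mono[OF finite_U E(1)] by simp
  ultimately show ?thesis by linarith
qed

text \<open>
  Elements of the monoid and vectors of natural numbers have integral heights, hence so do the
  class representatives. The class of zero, where the height is zero, needs separate treatment later.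
\<close>

lemma classes_height:
  assumes "f \<in> classes"
  obtains h where "height f = real h" and "f = 0 \<or> 1 \<le> h"
proof -
  from assms obtain s where s: "s \<in> sum_monoid U" "f = frac_vec s" by (auto simp: classes_def)
  obtain n where n: "s = f + nat_vec n"
    using nonneg_eq_frac_vec_add[of s] sum_monoid_nonneg[OF s(1)] s(2) by blast
  obtain k where k: "height s = real k"
    using s(1) height_nfold by (auto simp: sum_monoid_def)
  have "height f + real (sum n UNIV) = real k"
    unfolding k[symmetric] by (subst n) (simp only: height_add height_nat_vec)
  moreover have nn: "0 \<le> f $ i" for i by (simp add: s(2))
  moreover have "0 \<le> height f" unfolding height_def by (intro sum_nonneg nn)
  ultimately have h: "height f = real (k - sum n UNIV)" by linarith
  show ?thesis
  proof
    show "height f = real (k - sum n UNIV)" by (rule h)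
    have "f = 0" if "height f = 0"
      using that nn unfolding height_def by (subst (asm) sum_nonneg_eq_0_iff) (auto simp: vec_eq_iff)
    with h show "f = 0 \<or> 1 \<le> k - sum n UNIV" by (cases "k - sum n UNIV") auto
  qed
qed

lemma exists_vertex_minimal_below:
  assumes "f \<in> classes" and "f + nat_vec n \<in> sum_monoid U"
  obtains m where "\<And>i. m i \<le> n i" and "vertex_minimal (f + nat_vec m)"
proof -
  define P where "P m \<longleftrightarrow> (\<forall>i. m i \<le> n i) \<and> f + nat_vec m \<in> sum_monoid U" for m
  have "P n" using assms(2) by (simp add: P_def)
  from ex_has_least_nat[of P n "\<lambda>m. sum m UNIV", OF this]
  obtain m where m: "P m" and least: "\<And>m'. P m' \<Longrightarrow> sum m UNIV \<le> sum m' UNIV" by blast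
  have "f + nat_vec m - axis i 1 \<notin> sum_monoid U" for i
  proof
    assume A: "f + nat_vec m - axis i 1 \<in> sum_monoid U"
    \<comment> \<open>coordinates stay nonnegative, so only a vertex counted by \<open>m\<close> can be subtracted\<close>
    have "f $ i < 1" using assms(1) by (auto simp: classes_def frac_lt_1)
    moreover have "0 \<le> f $ i + real (m i) - 1"
      using sum_monoid_nonneg[OF A, of i] by (simp add: axis_def)
    ultimately have pos: "0 < m i" by (cases "m i") auto
    define m' where "m' = m(i := m i - 1)"
    have "f + nat_vec m' = f + nat_vec m - axis i 1"
      using pos by (auto simp: vec_eq_iff axis_def m'_def of_nat_diff)
    with A have "f + nat_vec m' \<in> sum_monoid U" by (simp only:)
    with m have "P m'" by (auto simp: P_def m'_def intro: le_trans[OF diff_le_self])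
    moreover have "sum m UNIV = Suc (sum m' UNIV)"
      using pos by (simp add: m'_def sum.remove[of UNIV i])
    ultimately show False using least by fastforce
  qed
  with m show ?thesis by (intro that[of m]) (auto simp: P_def vertex_minimal_def)
qed

lemma add_nat_vec_mono:
  assumes "f + nat_vec m \<in> sum_monoid U" and "\<And>i. m i \<le> n i"
  shows "f + nat_vec n \<in> sum_monoid U"
proof -
  have "f + nat_vec n = (f + nat_vec m) + nat_vec (\<lambda>i. n i - m i)"
    using assms(2) by (simp add: vec_eq_iff of_nat_diff)
  then show ?thesis using assms(1) by (simp only: sum_monoid_add nat_vec_in)
qed

text \<open>
  The bound from \<open>vertex_minimal_length\<close>. The truncated subtraction is harmless as soon as some
  vertex-minimal element exists, and zero is one.
\<close>

definition max_length :: nat where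
  "max_length = card classes + CARD('v) - card U"

lemma vertex_minimal_bounds:
  assumes "finite classes" and "vertex_minimal (f + nat_vec m)" and "height f = real h"
  shows "h + sum m UNIV \<le> max_length" and "card U + max_length = card classes + CARD('v)"
    and "1 \<le> max_length"
proof -
  have "height (f + nat_vec m) = real (h + sum m UNIV)"
    by (simp only: height_add height_nat_vec assms(3) of_nat_add)
  then have "f + nat_vec m \<in> nfold_sumset (h + sum m UNIV) U"
    using assms(2) by (simp only: nfold_iff vertex_minimal_def)
  from vertex_minimal_length[OF assms(2) this assms(1)]
  show "h + sum m UNIV \<le> max_length" "card U + max_length = card classes + CARD('v)"
    "1 \<le> max_length"
    unfolding max_length_def by linarith+
qed

lemma zero_vertex_minimal: "vertex_minimal (0 + nat_vec (\<lambda>_. 0))"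
proof -
  have "0 - axis i 1 \<notin> sum_monoid U" for i
  proof
    assume "0 - axis i 1 \<in> sum_monoid U"
    from sum_monoid_nonneg[OF this, of i] show False by simp
  qed
  moreover have "0 + nat_vec (\<lambda>_. 0) = (0 :: real ^ 'v)" by (simp add: vec_eq_iff)
  ultimately show ?thesis
    using sum_monoid_0 by (simp add: vertex_minimal_def)
qed

text \<open>
  In the class of zero everything lies above the element zero, so the truncation vector is zero. A
  vertex-minimal element of another class starts from height \<open>h \<ge> 1\<close>, which leaves at most
  \<open>max_length - h\<close> for each integer part. With \<open>D = CARD('v)\<close> the threshold becomes
  \<open>h + D * (max_length - h) - D + 1\<close>, which is largest for \<open>h = 1\<close>; this case gives the stated
  value.
\<close>

lemma polynomial_from_card_class:
  assumes fin: "finite classes" and f: "f \<in> classes" and h: "height f = real h"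
  shows "polynomial_from (int CARD('v) * (int max_length - 2) + 2)
           (\<lambda>N. card {n. f + nat_vec n \<in> sum_monoid U \<and> sum n UNIV + h = N})"
proof -
  let ?D = "int CARD('v)"
  let ?W = "{n. f + nat_vec n \<in> sum_monoid U}"
  define m where "m = (if f = 0 then 0 else max_length - h)"
  have "n \<in> ?W \<longleftrightarrow> (\<lambda>i. min (n i) m) \<in> ?W" for n
  proof
    assume "n \<in> ?W"
    then have n: "f + nat_vec n \<in> sum_monoid U" by simp
    show "(\<lambda>i. min (n i) m) \<in> ?W"
    proof (cases "f = 0")
      case True
      then show ?thesis using nat_vec_in by simp
    next
      case False
      obtain k where k: "\<And>i. k i \<le> n i" "vertex_minimal (f + nat_vec k)"
        using exists_vertex_minimal_below[OF f n] by blast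
      have k': "k i \<le> min (n i) m" for i
      proof -
        have "k i \<le> sum k UNIV" by (rule member_le_sum) auto
        moreover have "m = max_length - h" using False by (simp add: m_def)
        ultimately have "k i \<le> m" using vertex_minimal_bounds(1)[OF fin k(2) h] by linarith
        with k(1)[of i] show ?thesis by simp
      qed
      have "f + nat_vec k \<in> sum_monoid U" using k(2) by (simp only: vertex_minimal_def)
      from add_nat_vec_mono[OF this k'] show ?thesis by simp
    qed
  next
    assume "(\<lambda>i. min (n i) m) \<in> ?W"
    then show "n \<in> ?W" using add_nat_vec_mono[of f "\<lambda>i. min (n i) m" n] by simp
  qed
  then have "polynomial_from (int h + int (\<Sum>i\<in>(UNIV :: 'v set). m) - ?D + 1)
      (\<lambda>N. card {n\<in>?W. sum n UNIV + h = N})"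
    by (rule polynomial_from_card_truncation_closed)
  moreover have "int h + int (\<Sum>i\<in>(UNIV :: 'v set). m) - ?D + 1 \<le> ?D * (int max_length - 2) + 2"
  proof (cases "f = 0")
    case True
    then have "int h + int (\<Sum>i\<in>(UNIV :: 'v set). m) = 0"
      using h by (simp add: m_def height_def)
    moreover have "?D * 1 \<le> ?D * int max_length"
    proof (rule mult_left_mono)
      have "1 \<le> max_length"
        using zero_vertex_minimal by (rule vertex_minimal_bounds(3)[OF fin, of _ _ 0]) (simp add: height_def)
      then show "1 \<le> int max_length" by simp
    qed simp
    ultimately show ?thesis unfolding right_diff_distrib by linarith
  next
    case False
    obtain s where s: "s \<in> sum_monoid U" "f = frac_vec s" using f by (auto simp: classes_def)
    obtain n where "s = frac_vec s + nat_vec n"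
      using nonneg_eq_frac_vec_add[of s] sum_monoid_nonneg[OF s(1)] by blast
    with s have "f + nat_vec n \<in> sum_monoid U" by simp
    then obtain k where "vertex_minimal (f + nat_vec k)"
      using exists_vertex_minimal_below[OF f] by blast
    from vertex_minimal_bounds(1)[OF fin this h] have "h \<le> max_length" by simp
    then have "int h + int (\<Sum>i\<in>(UNIV :: 'v set). m) = ?D * int max_length - (?D - 1) * int h"
    proof -
      have "int m = int max_length - int h"
        using False \<open>h \<le> max_length\<close> by (simp add: m_def of_nat_diff)
      moreover have "int (\<Sum>i\<in>(UNIV :: 'v set). m) = ?D * int m" by simp
      ultimately show ?thesis by (simp only: left_diff_distrib right_diff_distrib)
    qed
    moreover
    obtain h' where "height f = real h'" and "f = 0 \<or> 1 \<le> h'"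
      by (rule classes_height[OF f])
    with h False have "1 \<le> h" by simp
    have "?D - 1 \<le> (?D - 1) * int h"
    proof -
      have "0 < CARD('v)" by simp
      then have "0 \<le> ?D - 1" by linarith
      moreover have "1 \<le> int h" using \<open>1 \<le> h\<close> by simp
      ultimately have "(?D - 1) * 1 \<le> (?D - 1) * int h" by (intro mult_left_mono)
      then show ?thesis by (simp only: mult_1_right)
    qed
    \<comment> \<open>the inequality with the products as variables, so that it is linear\<close>
    moreover have "x - D + 1 \<le> D * (K - 2) + 2" if "x = D * K - E" "D - 1 \<le> E" for x D K E :: int
      unfolding right_diff_distrib using that by linarith
    ultimately show ?thesis by blast
  qed
  ultimately have "polynomial_from (?D * (int max_length - 2) + 2)
      (\<lambda>N. card {n\<in>?W. sum n UNIV + h = N})" by (rule polynomial_from_mono)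
  then show ?thesis by simp
qed

lemma card_nfold_sumset:
  assumes fin: "finite classes"
  shows "card (nfold_sumset N U)
    = (\<Sum>f\<in>classes. card {n. f + nat_vec n \<in> sum_monoid U \<and> sum n UNIV + nat \<lfloor>height f\<rfloor> = N})"
proof -
  define C where "C f = {n. f + nat_vec n \<in> sum_monoid U \<and> sum n UNIV + nat \<lfloor>height f\<rfloor> = N}" for f
  have frac: "frac_vec (f + nat_vec n) = f" if f: "f \<in> classes" for f n
    using f by (auto simp: classes_def frac_vec_add_nat_vec frac_vec_idem)
  have nf: "f + nat_vec n \<in> nfold_sumset N U \<longleftrightarrow> n \<in> C f" if f: "f \<in> classes" for f n
  proof -
    obtain h where h: "height f = real h" by (rule classes_height[OF f])
    have "height (f + nat_vec n) = real (h + sum n UNIV)"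
      by (simp only: height_add height_nat_vec h of_nat_add)
    then have "height (f + nat_vec n) = real N \<longleftrightarrow> sum n UNIV + h = N" by linarith
    moreover have "nat \<lfloor>height f\<rfloor> = h" using h by simp
    ultimately show ?thesis unfolding nfold_iff C_def by (simp only: mem_Collect_eq)
  qed
  have "nfold_sumset N U = (\<Union>f\<in>classes. (\<lambda>n. f + nat_vec n) ` C f)"
  proof (intro set_eqI iffI)
    fix x assume x: "x \<in> nfold_sumset N U"
    then have S: "x \<in> sum_monoid U" by (simp add: nfold_iff)
    then have f: "frac_vec x \<in> classes" by (simp add: classes_def)
    obtain n where n: "x = frac_vec x + nat_vec n"
      using nonneg_eq_frac_vec_add[of x] sum_monoid_nonneg[OF S] by blast
    with x nf[OF f, of n] have "n \<in> C (frac_vec x)" by simp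
    with n f show "x \<in> (\<Union>f\<in>classes. (\<lambda>n. f + nat_vec n) ` C f)" by blast
  qed (use nf in auto)
  also have "card \<dots> = (\<Sum>f\<in>classes. card ((\<lambda>n. f + nat_vec n) ` C f))"
  proof (rule card_UN_disjoint[OF fin])
    show "\<forall>f\<in>classes. finite ((\<lambda>n. f + nat_vec n) ` C f)"
    proof (intro ballI finite_imageI)
      show "finite (C f)" for f
        unfolding C_def
        by (rule finite_subset[OF _ finite_bounded_sum[of "nat \<lfloor>height f\<rfloor>" N]]) auto
    qed
    show "\<forall>f\<in>classes. \<forall>g\<in>classes. f \<noteq> g \<longrightarrow>
        (\<lambda>n. f + nat_vec n) ` C f \<inter> (\<lambda>n. g + nat_vec n) ` C g = {}"
    proof (intro ballI impI equals0I)
      fix f g x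
      assume fg: "f \<in> classes" "g \<in> classes" "f \<noteq> g"
        and "x \<in> (\<lambda>n. f + nat_vec n) ` C f \<inter> (\<lambda>n. g + nat_vec n) ` C g"
      then obtain n m where "x = f + nat_vec n" "x = g + nat_vec m" by blast
      with fg frac[of f n] frac[of g m] show False by simp
    qed
  qed
  also have "\<dots> = (\<Sum>f\<in>classes. card (C f))"
    by (intro sum.cong refl card_image inj_onI) (simp add: vec_eq_iff fun_eq_iff)
  finally show ?thesis by (simp add: C_def)
qed

theorem polynomial_from_card_nfold_sumset:
  assumes fin: "finite classes"
  shows "polynomial_from
    (int CARD('v) * (int (card classes) - int (card U) + int CARD('v) - 2) + 2)
    (\<lambda>N. card (nfold_sumset N U))"
proof -
  have "polynomial_from (int CARD('v) * (int max_length - 2) + 2)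
      (\<lambda>N. \<Sum>f\<in>classes. card {n. f + nat_vec n \<in> sum_monoid U \<and> sum n UNIV + nat \<lfloor>height f\<rfloor> = N})"
  proof (rule polynomial_from_sum)
    fix f assume f: "f \<in> classes"
    obtain h where h: "height f = real h" by (rule classes_height[OF f])
    then have "nat \<lfloor>height f\<rfloor> = h" by simp
    with polynomial_from_card_class[OF fin f h]
    show "polynomial_from (int CARD('v) * (int max_length - 2) + 2)
      (\<lambda>N. card {n. f + nat_vec n \<in> sum_monoid U \<and> sum n UNIV + nat \<lfloor>height f\<rfloor> = N})"
      by (simp only:)
  qed
  moreover have "card U + max_length = card classes + CARD('v)"
    using zero_vertex_minimal by (rule vertex_minimal_bounds(2)[OF fin, of _ _ 0]) (simp add: height_def)
  then have "int max_length - 2 = int (card classes) - int (card U) + int CARD('v) - 2"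
    by linarith
  ultimately show ?thesis unfolding card_nfold_sumset[OF fin] by (simp only:)
qed

end

section \<open>Lattice points and volume\<close>

text \<open>
  Open unit cubes attached to distinct lattice points are disjoint and have volume one.
\<close>

lemma card_lattice_points_le_measure:
  fixes P :: "(real ^ 'd::finite) set"
  assumes "finite P" and "P \<subseteq> int_lattice" and K: "K \<in> lmeasurable"
    and sub: "\<And>x. x \<in> P \<Longrightarrow> (+) x ` box 0 1 \<subseteq> K"
  shows "real (card P) \<le> measure lebesgue K"
proof -
  let ?Q = "box 0 (1 :: real ^ 'd)"
  have Q: "measure lebesgue ?Q = 1"
  proof -
    have "measure lebesgue ?Q = measure lborel ?Q" by (rule measure_completion) simp
    also have "\<dots> = 1"
      by (subst measure_lborel_box_eq) (auto simp: Basis_vec_def inner_axis intro!: prod.neutral)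
    finally show ?thesis .
  qed
  have disj: "disjnt ((+) x ` ?Q) ((+) y ` ?Q)" if "x \<in> P" "y \<in> P" "x \<noteq> y" for x y
  proof (rule ccontr)
    assume "\<not> ?thesis"
    then obtain p q where pq: "p \<in> ?Q" "q \<in> ?Q" "x + p = y + q"
      unfolding disjnt_def by blast
    have "x $ i = y $ i" for i
    proof -
      have "x $ i \<in> \<int>" "y $ i \<in> \<int>" using that assms(2) by (auto simp: int_lattice_def)
      then obtain m n where mn: "x $ i = of_int m" "y $ i = of_int n" by (auto elim!: Ints_cases)
      have "x $ i + p $ i = y $ i + q $ i" using pq(3) by (metis vector_add_component)
      moreover have "0 < p $ i" "p $ i < 1" "0 < q $ i" "q $ i < 1"
        using pq(1,2) by (auto simp: mem_box_cart)
      ultimately have "real_of_int m - real_of_int n < 1" "real_of_int n - real_of_int m < 1"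
        unfolding mn by linarith+
      then have "m = n" by linarith
      then show ?thesis by (simp add: mn)
    qed
    with that(3) show False by (simp add: vec_eq_iff)
  qed
  have meas: "(+) x ` ?Q \<in> lmeasurable" for x
    by (intro measurable_translation) simp
  have "real (card P) = (\<Sum>x\<in>P. measure lebesgue ((+) x ` ?Q))"
    by (simp add: measure_translation Q)
  also have "\<dots> = measure lebesgue (\<Union>x\<in>P. (+) x ` ?Q)"
    using disj by (intro measure_UNION'[symmetric] assms(1) meas) (auto simp: pairwise_def)
  also have "\<dots> \<le> measure lebesgue K"
    using sub K assms(1) meas
    by (intro measure_mono_fmeasurable sets.finite_UN) (auto simp: fmeasurableD)
  finally show ?thesis .
qed

lemma power_le_fact_choose: "S ^ d \<le> fact d * ((S + d) choose d)"
proof (induction d)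
  case (Suc d)
  have "S ^ Suc d \<le> (S + Suc d) * (fact d * ((S + d) choose d))"
    unfolding power_Suc using Suc by (intro mult_mono) auto
  also have "\<dots> = fact d * (Suc (S + d) * ((S + d) choose d))" by (simp add: algebra_simps)
  also have "\<dots> = fact d * (Suc d * (Suc (S + d) choose Suc d))"
    by (simp only: Suc_times_binomial)
  also have "\<dots> = fact (Suc d) * ((S + Suc d) choose Suc d)" by (simp add: algebra_simps)
  finally show ?case .
qed simp

lemma choose_mono_upper: "m \<le> n \<Longrightarrow> (m choose k) \<le> (n choose k)"
proof (induction n rule: dec_induct)
  case (step n)
  have "(n choose k) \<le> (Suc n choose k)" by (cases k) auto
  with step show ?case by simp
qed simp

definition barycentric_map :: "('v::finite \<Rightarrow> 'a::real_vector) \<Rightarrow> real ^ 'v \<Rightarrow> 'a" where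
  "barycentric_map b x = (\<Sum>i\<in>UNIV. x $ i *\<^sub>R b i)"

lemma barycentric_map_add: "barycentric_map b (x + y) = barycentric_map b x + barycentric_map b y"
  by (simp add: barycentric_map_def scaleR_add_left sum.distrib)

lemma barycentric_map_0: "barycentric_map b 0 = 0"
  by (simp add: barycentric_map_def)

lemma barycentric_map_scaleR: "barycentric_map b (c *\<^sub>R x) = c *\<^sub>R barycentric_map b x"
  by (simp add: barycentric_map_def scaleR_sum_right)

lemma barycentric_map_in_hull:
  assumes "\<And>i. 0 \<le> x $ i" and "height x = 1"
  shows "barycentric_map b x \<in> convex hull (range b)"
  unfolding barycentric_map_def
  using assms by (intro convex_sum) (auto simp: height_def intro: hull_inc)

lemma barycentric_map_inj_height:
  assumes "\<And>x. height x = 0 \<Longrightarrow> barycentric_map b x = 0 \<Longrightarrow> x = 0"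
    and "height x = height y" and "barycentric_map b x = barycentric_map b y"
  shows "x = y"
proof -
  have "height (x + (- 1) *\<^sub>R y) = 0"
    using assms(2) by (simp add: height_def sum_subtractf)
  moreover have "barycentric_map b (x + (- 1) *\<^sub>R y) = 0"
    using assms(3) by (simp only: barycentric_map_add barycentric_map_scaleR) simp
  ultimately have "x + (- 1) *\<^sub>R y = 0" by (rule assms(1))
  then show ?thesis by simp
qed

text \<open>
  The assumption \<open>inj\<close> is affine independence of the vertices \<open>b\<close>, phrased for coordinate vectors.
\<close>

locale lattice_simplex = simplex_coordinates U
  for U :: "(real ^ 'v::finite) set" +
  fixes b :: "'v \<Rightarrow> real ^ 'd::finite"
  assumes card_index: "CARD('v) = CARD('d) + 1"
    and lattice: "barycentric_map b ` U \<subseteq> int_lattice"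
    and inj: "height x = 0 \<Longrightarrow> barycentric_map b x = 0 \<Longrightarrow> x = 0"
    and full: "affine hull (range b) = UNIV"
begin

lemmas inj_height = barycentric_map_inj_height[OF inj]

lemma sum_monoid_lattice:
  assumes "x \<in> sum_monoid U"
  shows "barycentric_map b x \<in> int_lattice"
proof -
  obtain k where "x \<in> nfold_sumset k U" using assms by (auto simp: sum_monoid_def)
  then have "barycentric_map b x \<in> nfold_sumset k (barycentric_map b ` U)"
    by (simp add: nfold_sumset_image barycentric_map_add barycentric_map_0)
  then obtain a where "barycentric_map b x = (\<Sum>i<k. a i)" "\<forall>i<k. a i \<in> int_lattice"
    using lattice by (auto simp: nfold_sumset_def) blast
  then show ?thesis by (auto simp: int_lattice_def intro!: Ints_sum)
qed

text \<open>
  A representative differs from an element of the monoid by an integer combination of vertices, and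
  all of these are lattice points.
\<close>

lemma class_lattice:
  assumes "f \<in> classes"
  shows "barycentric_map b (f + nat_vec n) \<in> int_lattice"
proof -
  obtain s where s: "s \<in> sum_monoid U" "f = frac_vec s" using assms by (auto simp: classes_def)
  obtain k where k: "s = f + nat_vec k"
    using nonneg_eq_frac_vec_add[of s] sum_monoid_nonneg[OF s(1)] s(2) by blast
  have "barycentric_map b (f + nat_vec n) + barycentric_map b (nat_vec k)
      = barycentric_map b s + barycentric_map b (nat_vec n)"
    unfolding k by (simp add: barycentric_map_add)
  then have "barycentric_map b (f + nat_vec n)
      = barycentric_map b s + barycentric_map b (nat_vec n) - barycentric_map b (nat_vec k)"
    by (simp add: algebra_simps)
  moreover have "barycentric_map b s \<in> int_lattice" "barycentric_map b (nat_vec n) \<in> int_lattice"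
    "barycentric_map b (nat_vec k) \<in> int_lattice"
    using s(1) nat_vec_in by (simp_all only: sum_monoid_lattice)
  ultimately show ?thesis by (simp add: int_lattice_def)
qed

text \<open>
  The height is an integer and a sum of \<open>d + 1\<close> numbers below one.
\<close>

lemma class_height_le:
  assumes "f \<in> classes" and "height f = real h"
  shows "h \<le> CARD('d)"
proof -
  have "height f < (\<Sum>i\<in>(UNIV :: 'v set). 1)"
    unfolding height_def using assms(1)
    by (intro sum_strict_mono) (auto simp: classes_def frac_lt_1)
  then show ?thesis using assms(2) card_index by simp
qed

text \<open>
  The simplex contains a neighbourhood of an interior point \<open>p\<close>, hence a scaled-down unit cube placed
  at \<open>p\<close>. By convexity, adding a unit cube to a dilate of the simplex then amounts to increasing the
  dilation factor by \<open>M\<close>, up to a translation.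
\<close>

lemma unit_cube_absorbed:
  obtains p and M :: nat
    where "0 < M" and "\<forall>q\<in>box 0 1. p + (1 / real M) *\<^sub>R q \<in> convex hull (range b)"
proof -
  let ?T = "convex hull (range b)"
  have "affine hull ?T = UNIV" using full by simp
  then have "rel_interior ?T = interior ?T" by (rule rel_interior_interior)
  moreover have "rel_interior ?T \<noteq> {}" by (subst rel_interior_eq_empty) auto
  ultimately obtain p where "p \<in> interior ?T" by blast
  then obtain e where e: "0 < e" "ball p e \<subseteq> ?T" by (auto simp: mem_interior)
  have "bounded (box 0 (1 :: real ^ 'd))" by (rule bounded_box)
  then obtain C where C: "0 < C" "\<forall>q\<in>box 0 (1 :: real ^ 'd). norm q \<le> C"
    by (auto simp: bounded_pos)
  obtain M :: nat where M: "C / e < real M" using reals_Archimedean2 by blast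
  then have "0 < real M" using C(1) e(1) by (meson divide_pos_pos less_trans)
  have "p + (1 / real M) *\<^sub>R q \<in> ?T" if "q \<in> box 0 1" for q
  proof -
    have "norm q < real M * e"
      using C(2) that M e(1) by (meson le_less_trans pos_divide_less_eq)
    then have "norm ((1 / real M) *\<^sub>R q) < e"
      using \<open>0 < real M\<close> by (simp add: divide_less_eq mult.commute)
    then have "p + (1 / real M) *\<^sub>R q \<in> ball p e" by (simp add: dist_norm)
    with e(2) show ?thesis by blast
  qed
  then show ?thesis using \<open>0 < real M\<close> by (intro that[of M p] ballI) auto
qed

text \<open>
  Put \<open>t = S + d\<close>. A class of height \<open>h \<le> d\<close> has \<open>(t - h + d) choose d\<close> vectors of height \<open>t\<close>, which
  is at least \<open>(S + d) choose d\<close> and hence at least \<open>S\<^sup>d / d!\<close>. Their images are distinct lattice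
  points of the simplex dilated by \<open>t\<close>, and the unit cubes at these points lie in a translate \<open>K\<close> of
  the simplex dilated by \<open>t + M\<close>.
\<close>

lemma packing_inequality:
  assumes R: "R \<subseteq> classes" "finite R"
    and M: "0 < M" "\<forall>q\<in>box 0 1. p + (1 / real M) *\<^sub>R q \<in> convex hull (range b)"
  shows "real (card R) * real S ^ CARD('d)
    \<le> fact CARD('d) * real (S + CARD('d) + M) ^ CARD('d) * measure lebesgue (convex hull (range b))"
proof -
  let ?d = "CARD('d)" and ?T = "convex hull (range b)"
  define t where "t = S + ?d"
  have t: "0 < t" by (simp add: t_def)
  define hh where "hh f = nat \<lfloor>height f\<rfloor>" for f :: "real ^ 'v"
  have hh: "height f = real (hh f)" "hh f \<le> ?d" if f: "f \<in> R" for f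
  proof -
    have "f \<in> classes" using f R(1) by blast
    obtain h where h: "height f = real h" by (rule classes_height[OF \<open>f \<in> classes\<close>])
    then have "hh f = h" by (simp add: hh_def)
    with h class_height_le[OF \<open>f \<in> classes\<close> h] show "height f = real (hh f)" "hh f \<le> ?d" by auto
  qed
  define C where "C f = {n :: 'v \<Rightarrow> nat. sum n UNIV = t - hh f}" for f
  define g where "g = (\<lambda>(f, n). barycentric_map b (f + nat_vec n))"
  define P where "P = g ` (SIGMA f:R. C f)"
  have ht: "height (f + nat_vec n) = real t" if "f \<in> R" "n \<in> C f" for f n
  proof -
    have "real (sum n UNIV) = real t - real (hh f)"
      using that hh(2)[OF that(1)] by (simp add: C_def t_def of_nat_diff del: of_nat_sum)
    then show ?thesis by (simp only: height_add height_nat_vec hh(1)[OF that(1)])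
  qed
  have finC: "finite (C f)" for f
    using finite_bounded_sum[of 0 "t - hh f", where 'v = 'v] by (simp add: C_def)
  have "finite (SIGMA f:R. C f)" using R(2) finC by blast
  have "inj_on g (SIGMA f:R. C f)"
  proof (rule inj_onI, clarify)
    fix f n f' n'
    assume f: "f \<in> R" "f' \<in> R" and n: "n \<in> C f" "n' \<in> C f'" and eq: "g (f, n) = g (f', n')"
    then have e: "f + nat_vec n = f' + nat_vec n'"
      by (intro inj_height) (simp_all add: ht g_def)
    have "frac_vec x = x" if "x \<in> R" for x
      using that R(1) by (auto simp: classes_def frac_vec_idem)
    with f have "f = f'" using arg_cong[OF e, of frac_vec] by (simp add: frac_vec_add_nat_vec)
    with e show "f = f' \<and> n = n'" by (simp add: vec_eq_iff fun_eq_iff)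
  qed
  then have "card P = (\<Sum>f\<in>R. card (C f))"
    unfolding P_def using R(2) finC by (simp add: card_image card_SigmaI)
  also have "\<dots> \<ge> (\<Sum>f\<in>R. (S + ?d) choose ?d)"
  proof (rule sum_mono)
    fix f assume "f \<in> R"
    have "card (C f) = (t - hh f + (CARD('v) - 1)) choose (CARD('v) - 1)"
      using card_compositions[of "UNIV :: 'v set" "t - hh f"] by (simp add: C_def)
    also have "\<dots> \<ge> (S + ?d) choose ?d"
      using hh(2)[OF \<open>f \<in> R\<close>] by (simp add: card_index t_def choose_mono_upper)
    finally show "(S + ?d) choose ?d \<le> card (C f)" .
  qed
  finally have "card R * ((S + ?d) choose ?d) \<le> card P" by simp
  then have "fact ?d * (card R * ((S + ?d) choose ?d)) \<le> fact ?d * card P"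
    by (rule mult_left_mono) simp
  moreover have "card R * S ^ ?d \<le> card R * (fact ?d * ((S + ?d) choose ?d))"
    by (intro mult_left_mono power_le_fact_choose) simp
  moreover have "card R * (fact ?d * ((S + ?d) choose ?d)) = fact ?d * (card R * ((S + ?d) choose ?d))"
    by (rule mult.left_commute)
  ultimately have "card R * S ^ ?d \<le> fact ?d * card P" by (metis le_trans)
  then have lower: "real (card R) * real S ^ ?d \<le> fact ?d * real (card P)"
    by (metis of_nat_fact of_nat_le_iff of_nat_mult of_nat_power)
  define K where "K = (\<lambda>z. real (t + M) *\<^sub>R z + (- real M) *\<^sub>R p) ` ?T"
  have "compact ?T" by (intro finite_imp_compact_convex_hull) simp
  then have "compact K"
    unfolding K_def by (intro compact_continuous_image continuous_intros)
  have "real (card P) \<le> measure lebesgue K"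
  proof (rule card_lattice_points_le_measure)
    show "finite P" unfolding P_def using \<open>finite (SIGMA f:R. C f)\<close> by (rule finite_imageI)
    show "P \<subseteq> int_lattice" using R(1) by (auto simp: P_def g_def intro: class_lattice)
    show "K \<in> lmeasurable" using \<open>compact K\<close> by (rule lmeasurable_compact)
    fix x assume "x \<in> P"
    then obtain f n where x: "f \<in> R" "n \<in> C f" "x = barycentric_map b (f + nat_vec n)"
      by (auto simp: P_def g_def)
    define y where "y = barycentric_map b ((1 / real t) *\<^sub>R (f + nat_vec n))"
    have "y \<in> ?T"
      unfolding y_def
    proof (rule barycentric_map_in_hull)
      have "f $ i \<ge> 0" for i using x(1) R(1) by (auto simp: classes_def)
      then show "0 \<le> ((1 / real t) *\<^sub>R (f + nat_vec n)) $ i" for i by simp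
      show "height ((1 / real t) *\<^sub>R (f + nat_vec n)) = 1"
        using ht[OF x(1,2)] t by (simp add: height_def flip: sum_divide_distrib)
    qed
    have xy: "x = real t *\<^sub>R y"
      using t by (simp only: y_def barycentric_map_scaleR x(3)) simp
    show "(+) x ` box 0 1 \<subseteq> K"
    proof (rule image_subsetI)
      fix q :: "real ^ 'd" assume q: "q \<in> box 0 1"
      \<comment> \<open>the convex combination that writes \<open>t y + q\<close> as \<open>(t + M) w - M p\<close>\<close>
      let ?z = "p + (1 / real M) *\<^sub>R q"
      let ?w = "(real t / real (t + M)) *\<^sub>R y + (real M / real (t + M)) *\<^sub>R ?z"
      have "?w \<in> ?T"
        using \<open>y \<in> ?T\<close> bspec[OF M(2) q] t
        by (intro convexD convex_convex_hull) (auto simp: add_divide_distrib[symmetric])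
      moreover have "x + q = real (t + M) *\<^sub>R ?w + (- real M) *\<^sub>R p"
        using t M(1) unfolding xy by (simp add: scaleR_add_right)
      ultimately show "x + q \<in> K" unfolding K_def by (rule rev_image_eqI)
    qed
  qed
  also have "\<dots> = real (t + M) ^ ?d * measure lebesgue ?T"
    unfolding K_def by (subst measure_lebesgue_affine) simp
  finally have "fact ?d * real (card P) \<le> fact ?d * (real (t + M) ^ ?d * measure lebesgue ?T)"
    by (intro mult_left_mono) auto
  from order_trans[OF lower this] show ?thesis by (simp only: t_def mult.assoc)
qed

text \<open>
  After division by \<open>S\<^sup>d\<close> the packing inequality tends to the claim as \<open>S\<close> grows. Since the bound
  applies to every finite set of classes, it also shows that there are only finitely many.
\<close>

lemma card_classes_le_volume:
  shows "finite classes" (is ?fin)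
    and "real (card classes) \<le> fact CARD('d) * measure lebesgue (convex hull (range b))" (is ?le)
proof -
  let ?d = "CARD('d)"
  define V where "V = fact ?d * measure lebesgue (convex hull (range b))"
  obtain p and M :: nat
    where M: "0 < M" "\<forall>q\<in>box 0 1. p + (1 / real M) *\<^sub>R q \<in> convex hull (range b)"
    by (rule unit_cube_absorbed)
  have le: "real (card R) \<le> V" if R: "R \<subseteq> classes" "finite R" for R
  proof (rule LIMSEQ_le_const)
    show "(\<lambda>S. (1 + real (?d + M) / real S) ^ ?d * V) \<longlonglongrightarrow> V"
      by (rule tendsto_eq_intros lim_const_over_n refl | simp)+
    have "real (card R) \<le> (1 + real (?d + M) / real S) ^ ?d * V" if "1 \<le> S" for S
    proof -
      have "real (card R) * real S ^ ?d \<le> real (S + ?d + M) ^ ?d * V"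
        using packing_inequality[OF R M, of S] by (simp add: V_def ac_simps)
      then have "real (card R) \<le> real (S + ?d + M) ^ ?d * V / real S ^ ?d"
        using that by (subst pos_le_divide_eq) auto
      also have "\<dots> = (real (S + ?d + M) / real S) ^ ?d * V" by (simp add: power_divide)
      also have "real (S + ?d + M) / real S = 1 + real (?d + M) / real S"
        using that by (simp add: add_divide_distrib)
      finally show ?thesis .
    qed
    then show "\<exists>N. \<forall>S\<ge>N. real (card R) \<le> (1 + real (?d + M) / real S) ^ ?d * V" by blast
  qed
  have "card R \<le> nat \<lfloor>V\<rfloor>" if "R \<subseteq> classes" "finite R" for R
    using le[OF that] by (simp add: le_nat_floor)
  then have "finite classes \<and> card classes \<le> nat \<lfloor>V\<rfloor>"
    by (rule finite_if_finite_subsets_card_bdd)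
  then show ?fin by blast
  then show ?le using le[of classes] by (simp add: V_def)
qed

end

section \<open>Sumsets of lattice points in a simplex\<close>

text \<open>
  The vertices span an affine space of dimension \<open>d\<close> and there are only \<open>d + 1\<close> of them, so they are
  affinely independent. They are indexed by \<open>'d option\<close>, a type with \<open>d + 1\<close> elements.
\<close>

lemma simplex_barycentric:
  fixes A :: "(real ^ 'd::finite) set"
  assumes "hull_is_simplex A"
  obtains b :: "'d option \<Rightarrow> real ^ 'd" where "range b \<subseteq> A" and "convex hull A = convex hull (range b)"
    and "affine hull (range b) = UNIV"
    and "\<forall>x. height x = 0 \<and> barycentric_map b x = 0 \<longrightarrow> x = 0"
    and "inj b"
proof -
  from assms obtain B where B: "B \<subseteq> A" "card B = CARD('d) + 1"
    and span: "span {x - y | x y. x \<in> B \<and> y \<in> B} = UNIV"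
    and hull: "convex hull A = convex hull B"
    by (auto simp: hull_is_simplex_def)
  have "finite B" using B(2) by (intro card_ge_0_finite) simp
  have "card B = CARD('d option)" using B(2) by simp
  then obtain b :: "'d option \<Rightarrow> real ^ 'd" where b: "bij_betw b UNIV B"
    using finite_same_card_bij[of "UNIV :: 'd option set" B] \<open>finite B\<close> by auto
  then have range: "range b = B" and "inj b" by (auto simp: bij_betw_def)
  obtain c where c: "c \<in> B" using range by blast
  have "span ((\<lambda>x. - c + x) ` B) = UNIV"
  proof -
    have "{x - y | x y. x \<in> B \<and> y \<in> B} \<subseteq> span ((\<lambda>x. - c + x) ` B)"
    proof clarify
      fix x y assume "x \<in> B" "y \<in> B"
      then have "(- c + x) - (- c + y) \<in> span ((\<lambda>x. - c + x) ` B)"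
        by (intro span_diff span_base) auto
      then show "x - y \<in> span ((\<lambda>x. - c + x) ` B)" by simp
    qed
    then have "span {x - y | x y. x \<in> B \<and> y \<in> B} \<subseteq> span ((\<lambda>x. - c + x) ` B)"
      by (simp add: span_minimal)
    with span show ?thesis by blast
  qed
  then have affine: "affine hull B = UNIV"
    unfolding affine_hull_span_gen[OF hull_inc[OF c]] by (simp add: surj_plus)
  have "aff_dim B = int CARD('d)"
    using affine aff_dim_eq_full[of B] by simp
  then have indep: "\<not> affine_dependent B"
    unfolding affine_independent_iff_card using \<open>finite B\<close> B(2) by simp
  have inj: "x = 0" if x: "height x = 0" "barycentric_map b x = 0" for x
  proof -
    define u where "u y = x $ (inv b y)" for y
    have u: "u (b i) = x $ i" for i using \<open>inj b\<close> by (simp add: u_def)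
    have "sum u B = height x"
      unfolding height_def using b by (subst sum.reindex_bij_betw[symmetric, of b UNIV B]) (auto simp: u)
    moreover have "(\<Sum>y\<in>B. u y *\<^sub>R y) = barycentric_map b x"
      unfolding barycentric_map_def using b
      by (subst sum.reindex_bij_betw[symmetric, of b UNIV B]) (auto simp: u)
    ultimately have "sum u B = 0 \<and> (\<Sum>y\<in>B. u y *\<^sub>R y) = 0" using x by (simp only:)
    then have "\<forall>y\<in>B. u y = 0"
      using indep unfolding affine_dependent_explicit_finite[OF \<open>finite B\<close>] by blast
    then have "u (b i) = 0" for i using range by blast
    then show ?thesis by (simp add: vec_eq_iff u)
  qed
  show ?thesis
  proof (rule that[of b])
    show "range b \<subseteq> A" using B(1) by (simp only: range)
    show "convex hull A = convex hull (range b)" using hull by (simp only: range)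
    show "affine hull (range b) = UNIV" using affine by (simp only: range)
    show "\<forall>x. height x = 0 \<and> barycentric_map b x = 0 \<longrightarrow> x = 0"
      by (intro allI impI) (elim conjE, rule inj)
    show "inj b" by fact
  qed
qed

theorem theorem1p4:
  fixes A :: "(real ^ 'd::finite) set" and N :: nat
  assumes "finite A" and "A \<subseteq> int_lattice"
    and "hull_is_simplex A"
    and "N \<ge> 1"
    and "real N \<ge> fact (CARD('d) + 1) * measure lebesgue (convex hull A)
           - (real CARD('d) + 1) * (real (card A) - real CARD('d)) - real CARD('d) + 1"
  shows "of_nat (card (nfold_sumset N A)) = poly (khovanskii_poly A) (of_nat N)"
proof -
  let ?d = "CARD('d)"
  obtain b :: "'d option \<Rightarrow> real ^ 'd"
    where bA: "range b \<subseteq> A" and hull: "convex hull A = convex hull (range b)"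
      and full: "affine hull (range b) = UNIV"
      and ker: "\<forall>x. height x = 0 \<and> barycentric_map b x = 0 \<longrightarrow> x = 0" and "inj b"
    by (rule simplex_barycentric[OF assms(3)])
  have inj: "x = 0" if "height x = 0" "barycentric_map b x = 0" for x
    using ker that by blast
  let ?\<beta> = "barycentric_map b"
  define U where "U = {x. (\<forall>i. 0 \<le> x $ i) \<and> height x = 1 \<and> ?\<beta> x \<in> A}"
  note inj_h = barycentric_map_inj_height[of b, OF inj]
  have inj_U: "inj_on ?\<beta> U" by (rule inj_onI, rule inj_h) (simp_all add: U_def)
  have image_U: "?\<beta> ` U = A"
  proof (intro equalityI subsetI)
    fix a assume "a \<in> A"
    then have "a \<in> convex hull A" by (rule hull_inc)
    then have "a \<in> convex hull (range b)" by (simp only: hull)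
    then have "\<exists>u. (\<forall>y\<in>range b. 0 \<le> u y) \<and> sum u (range b) = 1 \<and> (\<Sum>y\<in>range b. u y *\<^sub>R y) = a"
      by (simp only: convex_hull_finite[OF finite_imageI[OF finite]] mem_Collect_eq)
    then obtain u where u: "\<forall>y\<in>range b. 0 \<le> u y" "sum u (range b) = 1"
      "(\<Sum>y\<in>range b. u y *\<^sub>R y) = a" by blast
    define x where "x = (\<chi> i. u (b i))"
    have "height x = 1"
      using u(2) unfolding sum.reindex[OF \<open>inj b\<close>] by (simp add: height_def x_def)
    moreover have "?\<beta> x = a"
      using u(3) unfolding sum.reindex[OF \<open>inj b\<close>] by (simp add: barycentric_map_def x_def)
    moreover have "\<forall>i. 0 \<le> x $ i" using u(1) by (simp add: x_def)
    ultimately have "x \<in> U" "a = ?\<beta> x" using \<open>a \<in> A\<close> by (simp_all add: U_def)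
    then show "a \<in> ?\<beta> ` U" by (rule rev_image_eqI)
  next
    show "a \<in> A" if "a \<in> ?\<beta> ` U" for a using that by (auto simp: U_def)
  qed
  interpret lattice_simplex U b
  proof
    show "finite U" using inj_U by (rule finite_imageD[rotated]) (simp add: image_U assms(1))
    show "axis i 1 \<in> U" for i
    proof -
      have "(axis i 1 :: real ^ 'd option) $ j *\<^sub>R b j = (if j = i then b i else 0)" for j
        by (simp add: axis_def)
      then have "?\<beta> (axis i 1) = b i" by (simp add: barycentric_map_def)
      moreover have "height (axis i 1 :: real ^ 'd option) = 1"
        by (simp add: height_def axis_def)
      moreover have "\<forall>j. 0 \<le> (axis i 1 :: real ^ 'd option) $ j" by (simp add: axis_def)
      ultimately show ?thesis using bA by (simp add: U_def image_subset_iff)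
    qed
    show "0 \<le> u $ i" "height u = 1" if "u \<in> U" for u i
      using that by (simp_all add: U_def)
    show "?\<beta> ` U \<subseteq> int_lattice" using image_U assms(2) by simp
    show "CARD('d option) = CARD('d) + 1" by simp
    show "affine hull (range b) = UNIV" by fact
    show "x = 0" if "height x = 0" "?\<beta> x = 0" for x using that by (rule inj)
  qed
  have card_U: "card U = card A" using card_image[OF inj_U] image_U by simp
  have card_eq: "card (nfold_sumset n A) = card (nfold_sumset n U)" for n
  proof -
    have "nfold_sumset n A = ?\<beta> ` nfold_sumset n U"
      unfolding image_U[symmetric] by (intro nfold_sumset_image barycentric_map_add barycentric_map_0)
    moreover have "inj_on ?\<beta> (nfold_sumset n U)"
      by (rule inj_onI, rule inj_h) (simp_all add: height_nfold)
    ultimately show ?thesis by (simp add: card_image)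
  qed
  let ?c = "int CARD('d option) * (int (card classes) - int (card U) + int CARD('d option) - 2) + 2"
  show ?thesis
  proof (rule khovanskii_poly_eq)
    show "polynomial_from ?c (\<lambda>N. card (nfold_sumset N A))"
      unfolding card_eq by (rule polynomial_from_card_nfold_sumset[OF card_classes_le_volume(1)])
    let ?V = "measure lebesgue (convex hull A)"
    have arith: "(d + 1) * (V - a + (d + 1) - 2) + 2 = (d + 1) * V - (d + 1) * (a - d) - d + 1"
      for d V a :: real
      by (simp add: algebra_simps)
    have "real_of_int ?c
        = (real ?d + 1) * (real (card classes) - real (card A) + (real ?d + 1) - 2) + 2"
      by (simp add: card_U add.commute)
    also have "\<dots> = (real ?d + 1) * real (card classes)
        - (real ?d + 1) * (real (card A) - real ?d) - real ?d + 1"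
      by (rule arith)
    also have "\<dots> \<le> (real ?d + 1) * (fact ?d * ?V)
        - (real ?d + 1) * (real (card A) - real ?d) - real ?d + 1"
      unfolding hull
      by (intro add_right_mono diff_right_mono mult_left_mono card_classes_le_volume(2)) simp
    also have "(real ?d + 1) * (fact ?d * ?V) = fact (?d + 1) * ?V"
      by (simp add: add.commute)
    also note assms(5)
    finally have "real_of_int ?c \<le> real_of_int (int N)" by simp
    then show "?c \<le> int N" by (simp only: of_int_le_iff)
  qed
qed

end
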